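(* The minimum number of edges of a $5$-uniform intersecting hypergraph $H$ with $\tau(H)=5$ is $13$. That is, there exists a $5$-uniform intersecting hypergraph with exactly $13$ edges and covering number $5$, and every $5$-uniform intersecting hypergraph with covering number $5$ has at least $13$ edges.
   Context: Hypergraphs are finite and simple (no repeated edges). A hypergraph is $r$-uniform if every edge has exactly $r$ vertices, and intersecting if any two edges share at least one vertex. A cover of $H$ is a set of vertices meeting every edge; the covering number $\tau(H)$ is the minimum size of a cover. For an $r$-uniform intersecting hypergraph every edge is a cover, so $\tau(H)\le r$. *)

theory Defs
  imports Main
begin

text \<open>A hypergraph is given by its vertex set and its edge set. Edges form a set of sets, so
  no edge is repeated.\<close>

definition hypergraph :: "'a set \<Rightarrow> 'a set set \<Rightarrow> bool" where
  "hypergraph V E \<longleftrightarrow> finite V \<and> (\<forall>e\<in>E. e \<subseteq> V)"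

definition uniform :: "nat \<Rightarrow> 'a set set \<Rightarrow> bool" where
  "uniform r E \<longleftrightarrow> (\<forall>e\<in>E. card e = r)"

definition intersecting :: "'a set set \<Rightarrow> bool" where
  "intersecting E \<longleftrightarrow> (\<forall>e\<in>E. \<forall>f\<in>E. e \<inter> f \<noteq> {})"

definition cover :: "'a set \<Rightarrow> 'a set set \<Rightarrow> 'a set \<Rightarrow> bool" where
  "cover V E C \<longleftrightarrow> C \<subseteq> V \<and> (\<forall>e\<in>E. C \<inter> e \<noteq> {})"

text \<open>If no edge is empty, then \<open>V\<close> itself is a cover, so the minimum is attained.\<close>

definition covering_number :: "'a set \<Rightarrow> 'a set set \<Rightarrow> nat" where
  "covering_number V E = (LEAST n. \<exists>C. cover V E C \<and> card C = n)"

end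

theory Submission
  imports Defs
begin

text \<open>
  Lower bound. Pairing up edges shows that \<open>2 * k\<close> pairwise intersecting edges are covered by
  \<open>k\<close> vertices. The key step is that at most 8 pairwise intersecting edges of size 5 are covered by
  3 vertices. Given at most 12 edges, degree counting provides a vertex missing at most 8 of them,
  whence a cover of size 4.

  For the key step, a family that cannot be covered by 3 vertices must have exactly 8 edges and a
  vertex \<open>v\<close> on exactly 3 of them (the set \<open>F\<close>); every vertex is on at most two of the other 5
  edges (the set \<open>G\<close>), and two vertices never hit 6 edges together. Each edge of \<open>F\<close> has to meet the
  5 edges of \<open>G\<close> with the 4 vertices other than \<open>v\<close>, so it contains vertices lying on two edges of \<open>G\<close>.
  Viewing these vertices as edges of a graph with vertex set \<open>G\<close>, the three graphs belonging to the
  elements of \<open>F\<close> are cross-intersecting, which forces them to be stars; comparing their sizes gives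
  a contradiction.
\<close>

section \<open>Covers of bounded size, pairing and degree counting\<close>

definition coverable :: "nat \<Rightarrow> 'a set set \<Rightarrow> bool" where
  "coverable k E \<longleftrightarrow> (\<exists>C. finite C \<and> card C \<le> k \<and> (\<forall>e\<in>E. C \<inter> e \<noteq> {}))"

lemma coverable_Suc:
  assumes "coverable k {e \<in> E. v \<notin> e}"
  shows "coverable (Suc k) E"
proof -
  obtain C where C: "finite C" "card C \<le> k" "\<forall>e\<in>{e \<in> E. v \<notin> e}. C \<inter> e \<noteq> {}"
    using assms by (auto simp: coverable_def)
  then have "finite (insert v C) \<and> card (insert v C) \<le> Suc k \<and> (\<forall>e\<in>E. insert v C \<inter> e \<noteq> {})"
    by (auto simp: card_insert_if)
  then show ?thesis unfolding coverable_def by blast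
qed

lemma intersecting_subset: "intersecting E \<Longrightarrow> D \<subseteq> E \<Longrightarrow> intersecting D"
  by (auto simp: intersecting_def)

lemma uniform_subset: "uniform r E \<Longrightarrow> D \<subseteq> E \<Longrightarrow> uniform r D"
  by (auto simp: uniform_def)

text \<open>Two distinct edges share a vertex; putting it into the cover disposes of both.\<close>

lemma coverable_by_pairing:
  assumes "finite E" "intersecting E" "card E \<le> 2 * k"
  shows "coverable k E"
  using assms
proof (induction k arbitrary: E)
  case 0
  then have "E = {}" by simp
  then show ?case by (auto simp: coverable_def)
next
  case (Suc k)
  have "\<exists>v. card {e \<in> E. v \<notin> e} \<le> 2 * k"
  proof (cases "card E \<le> 1")
    case True
    show ?thesis
    proof (cases "E = {}")
      case False
      then obtain e where e: "E = {e}" using True Suc.prems(1)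
        by (metis One_nat_def card_1_singletonE card_gt_0_iff le_antisym Suc_leI)
      \<comment> \<open>\<open>intersecting\<close> also applies to \<open>e\<close> and itself, so
        \<open>e\<close> is nonempty.\<close>
      then obtain v where "v \<in> e" using Suc.prems(2) by (auto simp: intersecting_def)
      then have "{e \<in> E. v \<notin> e} = {}" using e by auto
      then show ?thesis by (metis card.empty zero_le)
    qed simp
  next
    case False
    then obtain e f where ef: "e \<in> E" "f \<in> E" "e \<noteq> f"
      using Suc.prems(1) by (auto simp: card_le_Suc0_iff_eq)
    then obtain v where "v \<in> e" "v \<in> f" using Suc.prems(2) by (auto simp: intersecting_def)
    then have "card {e \<in> E. v \<notin> e} \<le> card (E - {e, f})" using Suc.prems(1) by (intro card_mono) auto
    also have "\<dots> \<le> 2 * k" using Suc.prems ef by simp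
    finally show ?thesis by blast
  qed
  then obtain v where "card {e \<in> E. v \<notin> e} \<le> 2 * k" by blast
  then have "coverable k {e \<in> E. v \<notin> e}"
    using Suc.prems by (intro Suc.IH) (auto intro: intersecting_subset)
  then show ?case by (rule coverable_Suc)
qed

text \<open>Every edge meets a fixed edge \<open>e\<close>, and each of the \<open>r\<close>
  vertices of \<open>e\<close> lies on at most \<open>d\<close> edges other than
  \<open>e\<close>.\<close>

lemma card_le_if_degrees_le:
  assumes "0 < r" "finite E" "uniform r E" "intersecting E" "\<And>v. card {e \<in> E. v \<in> e} \<le> Suc d"
  shows "card E \<le> r * d + 1"
proof (cases "E = {}")
  case False
  then obtain e where e: "e \<in> E" by blast
  have r: "card e = r" using assms(3) e by (auto simp: uniform_def)
  have fe: "finite e" using r assms(1) by (simp add: card_ge_0_finite)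
  have "E - {e} \<subseteq> (\<Union>v\<in>e. {f \<in> E. v \<in> f} - {e})"
  proof
    fix f assume f: "f \<in> E - {e}"
    then obtain v where "v \<in> e" "v \<in> f" using assms(4) e by (auto simp: intersecting_def)
    then show "f \<in> (\<Union>v\<in>e. {f \<in> E. v \<in> f} - {e})" using f by blast
  qed
  then have "card (E - {e}) \<le> card (\<Union>v\<in>e. {f \<in> E. v \<in> f} - {e})"
    using assms(2) fe by (intro card_mono) auto
  also have "\<dots> \<le> (\<Sum>v\<in>e. card ({f \<in> E. v \<in> f} - {e}))" by (rule card_UN_le[OF fe])
  also have "\<dots> \<le> (\<Sum>v\<in>e. d)"
  proof (rule sum_mono)
    fix v assume "v \<in> e"
    then show "card ({f \<in> E. v \<in> f} - {e}) \<le> d" using assms(5)[of v] e by simp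
  qed
  finally show ?thesis using r e assms(2) by simp
qed simp

section \<open>Cross-intersecting graphs on five points\<close>

text \<open>
  The purely graph-theoretic part of the argument: \<open>F\<close> consists of the edges through \<open>v\<close>, \<open>G\<close> of the
  other edges, \<open>g x\<close> is the set of edges in \<open>G\<close> through \<open>x\<close>, and \<open>X e\<close> is the set of vertices of
  \<open>e\<close> with \<open>card (g x) = 2\<close>.
\<close>

lemma no_cross_intersecting_pair_systems:
  fixes X :: "'e \<Rightarrow> 'v set" and g :: "'v \<Rightarrow> 'i set"
  defines "U e \<equiv> \<Union>(g ` X e)"
  assumes F: "card F = 3" and G: "card G = 5"
    and fin: "\<And>e. e \<in> F \<Longrightarrow> finite (X e)"
    and pair: "\<And>e x. \<lbrakk>e \<in> F; x \<in> X e\<rbrakk> \<Longrightarrow> g x \<subseteq> G \<and> card (g x) = 2"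
    and cross: "\<And>e e' x y. \<lbrakk>e \<in> F; e' \<in> F; e \<noteq> e'; x \<in> X e; y \<in> X e'\<rbrakk> \<Longrightarrow> g x \<inter> g y \<noteq> {}"
    and missed: "\<And>e e' e'' i x. \<lbrakk>e \<in> F; e' \<in> F; e'' \<in> F; e \<noteq> e'; e \<noteq> e''; e' \<noteq> e''; i \<in> G;
        i \<notin> U e; i \<notin> U e'; x \<in> X e''\<rbrakk> \<Longrightarrow> i \<in> g x"
    and large: "\<And>e. e \<in> F \<Longrightarrow> card (X e) < card (U e)"
    and common: "\<And>e e' e'' c. \<lbrakk>e \<in> F; e' \<in> F; e'' \<in> F; e \<noteq> e'; e \<noteq> e''; e' \<noteq> e''; c \<in> G;
        \<forall>x \<in> X e \<union> X e' \<union> X e''. c \<in> g x\<rbrakk> \<Longrightarrow> card (X e) + card (X e') + card (X e'') \<le> 5"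
  shows False
proof -
  have finG: "finite G" using G by (simp add: card_ge_0_finite)
  have UG: "U e \<subseteq> G" if "e \<in> F" for e using pair[OF that] by (auto simp: U_def)
  have finU: "finite (U e)" if "e \<in> F" for e using UG[OF that] finG finite_subset by blast
  have fing: "finite (g x)" if "e \<in> F" "x \<in> X e" for e x
    using pair[OF that] by (simp add: card_ge_0_finite)
  have others: "\<exists>e' e''. e' \<in> F \<and> e'' \<in> F \<and> e \<noteq> e' \<and> e \<noteq> e'' \<and> e' \<noteq> e''" if "e \<in> F" for e
  proof -
    have "card (F - {e}) = 2" using F that by simp
    then show ?thesis by (auto simp: card_2_iff)
  qed
  have ne: "\<exists>x. x \<in> X e" if "e \<in> F" for e
    using large[OF that] by (cases "X e = {}") (auto simp: U_def)
  have two: "g x = {i, j}" if "e \<in> F" "x \<in> X e" "i \<in> g x" "j \<in> g x" "i \<noteq> j" for e x i j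
    using pair[OF that(1,2)] that(3-5) by (auto simp: card_2_iff)
  \<comment> \<open>Two disjoint pairs leave a fifth point \<open>i\<close> of \<open>G\<close>. A
    pair of another graph meets both, so it avoids \<open>i\<close>. Hence both other graphs miss
    \<open>i\<close>, and \<open>missed\<close> puts \<open>i\<close> into
    \<open>g x\<close>.\<close>
  have inter: "g x \<inter> g y \<noteq> {}" if e: "e \<in> F" and x: "x \<in> X e" and y: "y \<in> X e" for e x y
  proof
    assume dis: "g x \<inter> g y = {}"
    have "card (g x \<union> g y) = 4"
      using card_Un_disjoint[OF fing[OF e x] fing[OF e y] dis] pair[OF e x] pair[OF e y] by simp
    then have "\<not> G \<subseteq> g x \<union> g y"
      using G card_mono[of "g x \<union> g y" G] fing[OF e x] fing[OF e y] by auto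
    then obtain i where i: "i \<in> G" "i \<notin> g x" "i \<notin> g y" by blast
    have miss: "i \<notin> U e'" if e': "e' \<in> F" "e \<noteq> e'" for e'
    proof
      assume "i \<in> U e'"
      then obtain z where z: "z \<in> X e'" "i \<in> g z" by (auto simp: U_def)
      obtain a b where ab: "a \<in> g z" "a \<in> g x" "b \<in> g z" "b \<in> g y"
        using cross[OF e e' x z(1)] cross[OF e e' y z(1)] by blast
      then have "g z = {a, b}" using two[OF e'(1) z(1)] dis by blast
      then show False using z(2) i(2,3) ab by auto
    qed
    obtain e' e'' where "e' \<in> F" "e'' \<in> F" "e \<noteq> e'" "e \<noteq> e''" "e' \<noteq> e''"
      using others[OF e] by blast
    then show False using missed[of e' e'' e i x] miss i e x by blast
  qed
  \<comment> \<open>Pairwise intersecting pairs form a star or a triangle. A triangle spans three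
    points and uses at least three elements of \<open>X e\<close>, contrary to
    \<open>large\<close>.\<close>
  have centre: "\<exists>c\<in>G. \<forall>x\<in>X e. c \<in> g x" if e: "e \<in> F" for e
  proof (rule ccontr)
    assume no: "\<not> ?thesis"
    obtain x where x: "x \<in> X e" using ne[OF e] by blast
    obtain a b where gx: "g x = {a, b}" "a \<noteq> b" using pair[OF e x] by (auto simp: card_2_iff)
    obtain y where y: "y \<in> X e" "a \<notin> g y" using no pair[OF e x] gx by blast
    obtain z where z: "z \<in> X e" "b \<notin> g z" using no pair[OF e x] gx by blast
    have by': "b \<in> g y" using inter[OF e x y(1)] gx y by auto
    have az: "a \<in> g z" using inter[OF e x z(1)] gx z by auto
    obtain c where c: "c \<in> g y" "c \<in> g z" using inter[OF e y(1) z(1)] by blast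
    have cab: "c \<noteq> a" "c \<noteq> b" using c y z by blast+
    have gy: "g y = {b, c}" using two[OF e y(1) by' c(1)] cab by blast
    have gz: "g z = {a, c}" using two[OF e z(1) az c(2)] cab by blast
    have "g t \<subseteq> {a, b, c}" if t: "t \<in> X e" for t
    proof -
      have "a \<in> g t \<and> b \<in> g t \<or> b \<in> g t \<and> c \<in> g t \<or> a \<in> g t \<and> c \<in> g t"
        using inter[OF e t x] inter[OF e t y(1)] inter[OF e t z(1)] gx gy gz by auto
      then show ?thesis
        using two[OF e t, of a b] two[OF e t, of b c] two[OF e t, of a c] gx(2) cab by auto
    qed
    then have "U e \<subseteq> {a, b, c}" by (auto simp: U_def)
    then have "card (U e) \<le> card {a, b, c}" by (rule card_mono[rotated]) simp
    also have "\<dots> \<le> 3" using card_insert_le_m1 by (simp add: card_insert_if)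
    finally have "card (U e) \<le> 3" .
    moreover have "x \<noteq> y" "x \<noteq> z" "y \<noteq> z" using gx(1) y(2) z(2) az by auto
    then have "card {x, y, z} = 3" by simp
    then have "3 \<le> card (X e)" using card_mono[OF fin[OF e], of "{x, y, z}"] x y z by simp
    ultimately show False using large[OF e] by simp
  qed
  \<comment> \<open>The star of \<open>e\<close> has at least three leaves. A pair of another graph
    avoiding the centre \<open>c\<close> would contain all of them; so every pair contains
    \<open>c\<close>, and \<open>common\<close> applies.\<close>
  have in_all: "card (X e) + card (X e') + card (X e'') \<le> 5"
    if d: "e \<in> F" "e' \<in> F" "e'' \<in> F" "e \<noteq> e'" "e \<noteq> e''" "e' \<noteq> e''" and big: "4 \<le> card (U e)" for e e' e''
  proof -
    obtain c where c: "c \<in> G" "\<forall>x\<in>X e. c \<in> g x" using centre[OF d(1)] by blast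
    have "c \<in> g z" if f: "f \<in> F" "e \<noteq> f" and z: "z \<in> X f" for f z
    proof (rule ccontr)
      assume cz: "c \<notin> g z"
      have "U e - {c} \<subseteq> g z"
      proof
        fix i assume "i \<in> U e - {c}"
        then obtain x where x: "x \<in> X e" "i \<in> g x" "i \<noteq> c" by (auto simp: U_def)
        then have "g x = {c, i}" using two[OF d(1) x(1)] c by blast
        then show "i \<in> g z" using cross[OF d(1) f x(1) z] cz by auto
      qed
      then have "card (U e - {c}) \<le> card (g z)" using fing[OF f(1) z] card_mono by blast
      then show False using pair[OF f(1) z] big by (simp add: card_Diff_singleton_if split: if_splits)
    qed
    then show ?thesis using common[OF d c(1)] c(2) d by blast
  qed
  \<comment> \<open>Each element of \<open>X e\<close> contributes one point besides the
    centre.\<close>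
  have small: "card (U e) \<le> card (X e) + 1" if e: "e \<in> F" for e
  proof -
    obtain c where c: "c \<in> G" "\<forall>x\<in>X e. c \<in> g x" using centre[OF e] by blast
    have "card (g x - {c}) = 1" if "x \<in> X e" for x using pair[OF e that] c that by simp
    then have "card (\<Union>x\<in>X e. g x - {c}) \<le> card (X e)"
      using card_UN_le[OF fin[OF e], of "\<lambda>x. g x - {c}"] by simp
    moreover have "(\<Union>x\<in>X e. g x - {c}) = U e - {c}" by (auto simp: U_def)
    ultimately have "card (U e - {c}) \<le> card (X e)" by argo
    then show ?thesis by (simp add: card_Diff_singleton_if split: if_splits)
  qed
  have ge2: "2 \<le> card (U e)" if e: "e \<in> F" for e
  proof -
    obtain x where x: "x \<in> X e" using ne[OF e] by blast
    then have "g x \<subseteq> U e" by (auto simp: U_def)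
    then show ?thesis using pair[OF e x] card_mono[OF finU[OF e]] by metis
  qed
  show False
  proof (cases "\<exists>e\<in>F. card (U e) = 2")
    case True
    then obtain e where e: "e \<in> F" "card (U e) = 2" by blast
    obtain x where x: "x \<in> X e" using ne[OF e(1)] by blast
    have Ux: "U e = g x"
      using card_subset_eq[OF finU[OF e(1)], of "g x"] pair[OF e(1) x] e x by (auto simp: U_def)
    have cR: "card (G - g x) = 3"
      using card_Diff_subset[OF fing[OF e(1) x]] pair[OF e(1) x] G by simp
    \<comment> \<open>If \<open>i\<close> were missed by \<open>e\<close> and \<open>f\<close>,
      every pair of \<open>h\<close> would contain \<open>i\<close>. No other point \<open>j\<close>
      outside \<open>g x\<close> is in \<open>U h\<close>, since \<open>{i, j}\<close> is disjoint
      from \<open>g x\<close>. So every pair of \<open>f\<close> consists of the two remaining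
      points outside \<open>g x\<close>, contrary to \<open>cross\<close>.\<close>
    have sub: "G - g x \<subseteq> U f"
      if f: "f \<in> F" "h \<in> F" "e \<noteq> f" "e \<noteq> h" "f \<noteq> h" for f h
    proof
      fix i assume i: "i \<in> G - g x"
      show "i \<in> U f"
      proof (rule ccontr)
        assume "i \<notin> U f"
        then have ih: "i \<in> g z" if "z \<in> X h" for z
          using missed[of e f h i z] that f e(1) i Ux by blast
        have Uh: "j \<notin> U h" if "j \<in> G - g x" "j \<noteq> i" for j
        proof
          assume "j \<in> U h"
          then obtain z where z: "z \<in> X h" "j \<in> g z" by (auto simp: U_def)
          then have "g z = {i, j}" using two[OF f(2) z(1)] ih that by blast
          then show False using cross[OF e(1) f(2) f(4) x z(1)] that i by auto
        qed
        have jf: "j \<in> g y" if "j \<in> G - g x" "j \<noteq> i" "y \<in> X f" for j y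
          using missed[of e h f j y] that f e(1) Uh Ux by blast
        have "card (G - g x - {i}) = 2" using cR i by simp
        then obtain j k where jk: "j \<noteq> k" "G - g x - {i} = {j, k}" by (auto simp: card_2_iff)
        obtain y where y: "y \<in> X f" using ne[OF f(1)] by blast
        have "g y = {j, k}" using two[OF f(1) y] jf y jk by blast
        then show False using cross[OF e(1) f(1,3) x y] jk by auto
      qed
    qed
    have big: "4 \<le> card (U f)"
      if f: "f \<in> F" "h \<in> F" "e \<noteq> f" "e \<noteq> h" "f \<noteq> h" for f h
    proof -
      obtain y where y: "y \<in> X f" using ne[OF f(1)] by blast
      obtain i where i: "i \<in> g x" "i \<in> g y" using cross[OF e(1) f(1,3) x y] by blast
      have "insert i (G - g x) \<subseteq> U f" using sub[OF f] i y by (auto simp: U_def)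
      then have "card (insert i (G - g x)) \<le> card (U f)" using finU[OF f(1)] card_mono by blast
      then show ?thesis using cR i finG by simp
    qed
    obtain f h where fh: "f \<in> F" "h \<in> F" "e \<noteq> f" "e \<noteq> h" "f \<noteq> h" using others[OF e(1)] by blast
    have "4 \<le> card (U f)" "4 \<le> card (U h)" using big[of f h] big[of h f] fh by auto
    \<comment> \<open>By \<open>small\<close>, \<open>X f\<close> and \<open>X h\<close> have at
      least three elements each, six in total, against the bound 5.\<close>
    then show False using in_all[of f h e] small[of f] small[of h] fh e by auto
  next
    case False
    then have ge3: "3 \<le> card (U e)" if "e \<in> F" for e using ge2[OF that] that
      by (metis Suc_leI eval_nat_numeral(3) le_neq_implies_less)
    \<comment> \<open>If \<open>i\<close> were in neither, every pair of \<open>h\<close> would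
      contain \<open>i\<close>, and the other ends, at least two, would lie in every pair of
      \<open>e\<close>. All pairs of \<open>e\<close> would coincide, leaving \<open>U e\<close>
      only two points.\<close>
    have un: "i \<in> U f" if f: "e \<in> F" "f \<in> F" "h \<in> F" "e \<noteq> f" "e \<noteq> h" "f \<noteq> h" and i: "i \<in> G" "i \<notin> U e"
      for e f h i
    proof (rule ccontr)
      assume nf: "i \<notin> U f"
      have ih: "i \<in> g z" if "z \<in> X h" for z
        using missed[of e f h i z] that f i nf by blast
      have "U h - {i} \<subseteq> g y" if y: "y \<in> X e" for y
      proof
        fix p assume "p \<in> U h - {i}"
        then obtain z where z: "z \<in> X h" "p \<in> g z" "p \<noteq> i" by (auto simp: U_def)
        then have "g z = {i, p}" using two[OF f(3) z(1)] ih by blast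
        moreover have "i \<notin> g y" using i y by (auto simp: U_def)
        ultimately show "p \<in> g y" using cross[OF f(1,3,5) y z(1)] by auto
      qed
      moreover have "2 \<le> card (U h - {i})" using ge3[OF f(3)] diff_card_le_card_Diff[of "{i}" "U h"]
        by simp
      ultimately have "U h - {i} = g y" if "y \<in> X e" for y
        using card_seteq[OF fing[OF f(1) that]] pair[OF f(1) that] that by metis
      then have "U e \<subseteq> U h - {i}" by (auto simp: U_def)
      moreover obtain y where y: "y \<in> X e" using ne[OF f(1)] by blast
      ultimately have "U e \<subseteq> g y" using \<open>\<And>y. y \<in> X e \<Longrightarrow> U h - {i} = g y\<close> by blast
      then have "card (U e) \<le> card (g y)" using card_mono fing[OF f(1) y] by blast
      then show False using ge3[OF f(1)] pair[OF f(1) y] by simp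
    qed
    obtain e where e: "e \<in> F" using F by fastforce
    obtain f h where fh: "f \<in> F" "h \<in> F" "e \<noteq> f" "e \<noteq> h" "f \<noteq> h" using others[OF e] by blast
    \<comment> \<open>A point is missed by at most one of the three graphs, so the sizes of the sets
      \<open>U\<close> sum to at least 3 * 5 - 5 = 10.\<close>
    have disj: "(G - U e) \<inter> (G - U f) = {}" "(G - U e) \<inter> (G - U h) = {}" "(G - U f) \<inter> (G - U h) = {}"
      using un[of e f h] un[of e h f] un[of f h e] e fh by blast+
    have "card (G - U e) + card (G - U f) + card (G - U h) = card ((G - U e) \<union> (G - U f) \<union> (G - U h))"
      using disj finG by (simp add: card_Un_disjoint Int_Un_distrib2)
    also have "\<dots> \<le> card G" using finG by (intro card_mono) auto
    finally have "10 \<le> card (U e) + card (U f) + card (U h)"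
      using G card_Diff_subset[OF finU UG, OF e e] card_Diff_subset[OF finU UG, OF fh(1) fh(1)]
        card_Diff_subset[OF finU UG, OF fh(2) fh(2)] by linarith
    then have sum: "7 \<le> card (X e) + card (X f) + card (X h)"
      and "4 \<le> card (U e) \<or> 4 \<le> card (U f) \<or> 4 \<le> card (U h)"
      using small[OF e] small[OF fh(1)] small[OF fh(2)] large[OF e] large[OF fh(1)] large[OF fh(2)]
      by linarith+
    then show False
      using in_all[OF e fh] in_all[OF fh(1) e fh(2) fh(3)[symmetric] fh(5,4)]
        in_all[OF fh(2) e fh(1) fh(4)[symmetric] fh(5)[symmetric] fh(3)] by auto
  qed
qed

section \<open>Eight edges: a cover of size 3\<close>

lemma coverable_3_if_card_le_8:
  assumes fin: "finite E" and unif: "uniform 5 E" and int: "intersecting E" and card: "card E \<le> 8"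
  shows "coverable 3 E"
proof (rule ccontr)
  assume nc: "\<not> coverable 3 E"
  have split: "card E = card {e \<in> E. P e} + card {e \<in> E. \<not> P e}" for P
    using fin by (subst card_Un_disjoint[symmetric]) (auto intro: arg_cong[where f = card])
  have meet: "\<exists>x. x \<in> e \<and> x \<in> f" if "e \<in> E" "f \<in> E" for e f
    using int that by (auto simp: intersecting_def)
  \<comment> \<open>Four remaining edges would have a cover of size 2 by pairing, which
    \<open>u\<close> completes.\<close>
  have one: "5 \<le> card {e \<in> E. u \<notin> e}" for u
  proof (rule ccontr)
    assume "\<not> ?thesis"
    then have "coverable 2 {e \<in> E. u \<notin> e}"
      using fin int by (intro coverable_by_pairing) (auto intro: intersecting_subset)
    then show False using nc coverable_Suc[of 2 E u] by (simp add: numeral_2_eq_2 numeral_3_eq_3)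
  qed
  have two: "3 \<le> card {e \<in> E. u \<notin> e \<and> w \<notin> e}" for u w
  proof (rule ccontr)
    assume "\<not> ?thesis"
    then have "coverable 1 {e \<in> E. u \<notin> e \<and> w \<notin> e}"
      using fin int by (intro coverable_by_pairing) (auto intro: intersecting_subset)
    then have "coverable (Suc 1) {e \<in> E. u \<notin> e}" by (intro coverable_Suc[of 1 _ w]) simp
    then show False using nc coverable_Suc[of 2 E u] by (simp add: numeral_2_eq_2 numeral_3_eq_3)
  qed
  \<comment> \<open>Of the at most 8 edges only two would remain, contrary to
    \<open>two\<close>.\<close>
  have six: False if "A \<subseteq> E" "6 \<le> card A" "\<And>e. e \<in> A \<Longrightarrow> u \<in> e \<or> w \<in> e" for A u w
  proof -
    have "{e \<in> E. u \<notin> e \<and> w \<notin> e} \<subseteq> E - A" using that(3) by auto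
    then have "card {e \<in> E. u \<notin> e \<and> w \<notin> e} \<le> card (E - A)" using fin by (intro card_mono) auto
    also have "\<dots> \<le> 2" using that(1,2) card fin by (simp add: card_Diff_subset finite_subset)
    finally show False using two[of u w] by simp
  qed
  \<comment> \<open>Degrees at most 2 would leave at most 5 * 1 + 1 = 6 edges, which pairing covers
    by 3 vertices.\<close>
  have "\<exists>v. 3 \<le> card {e \<in> E. v \<in> e}"
  proof (rule ccontr)
    assume "\<not> ?thesis"
    then have "card {e \<in> E. v \<in> e} \<le> Suc 1" for v
      by (simp add: not_le) (metis less_Suc_eq_le numeral_3_eq_3 numeral_2_eq_2)
    then have "card E \<le> 2 * 3" using card_le_if_degrees_le[OF _ fin unif int, of 1] by simp
    then show False using nc coverable_by_pairing[OF fin int] by blast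
  qed
  then obtain v where v: "3 \<le> card {e \<in> E. v \<in> e}" by blast
  define F where "F = {e \<in> E. v \<in> e}"
  define G where "G = {e \<in> E. v \<notin> e}"
  define g where "g x = {e \<in> G. x \<in> e}" for x
  define X where "X e = {x \<in> e. card (g x) = 2}" for e
  \<comment> \<open>At least 3 edges contain \<open>v\<close> and at least 5 miss it, out of at most
    8, so both bounds are attained.\<close>
  have cF: "card F = 3" and cG: "card G = 5"
    using v one[of v] split[of "\<lambda>e. v \<in> e"] card by (auto simp: F_def G_def)
  have finG: "finite G" using fin by (simp add: G_def)
  have fing: "finite (g x)" for x using finG by (simp add: g_def)
  have gG: "g x \<subseteq> G" for x by (auto simp: g_def)
  have FE: "e \<in> E" "v \<in> e" "e \<notin> G" if "e \<in> F" for e using that by (auto simp: F_def G_def)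
  have Fg: "e \<notin> g x" if "e \<in> F" for e x using FE(3)[OF that] gG by blast
  have GE: "i \<in> E" "v \<notin> i" if "i \<in> G" for i using that by (auto simp: G_def)
  have c5: "card e = 5" "finite e" if "e \<in> E" for e
    using unif that by (auto simp: uniform_def card_ge_0_finite)
  have g2: "card (g x) \<le> 2" for x
  proof -
    have "{e \<in> E. v \<notin> e \<and> x \<notin> e} = G - g x" by (auto simp: G_def g_def)
    then have "3 \<le> card (G - g x)" using two[of v x] by simp
    then show ?thesis using cG card_Diff_subset[OF fing gG] card_mono[OF finG gG, of x] by simp
  qed
  have Xe: "x \<in> e" "x \<noteq> v" "card (g x) = 2" if "x \<in> X e" for x e
    using that by (auto simp: X_def g_def G_def)
  \<comment> \<open>A vertex where \<open>e\<close> meets \<open>i\<close> is outside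
    \<open>X e\<close>, so it lies on no edge of \<open>G\<close> but \<open>i\<close>: it is
    private to \<open>i\<close>.\<close>
  have single: "\<exists>z\<in>e. g z = {i}" if e: "e \<in> F" and i: "i \<in> G" "i \<notin> \<Union>(g ` X e)" for e i
  proof -
    obtain z where z: "z \<in> e" "z \<in> i" using meet[OF FE(1)[OF e] GE(1)[OF i(1)]] by blast
    then have iz: "i \<in> g z" using i by (auto simp: g_def)
    then have "card (g z) \<noteq> 2" using i z by (auto simp: X_def)
    moreover have "card (g z) \<noteq> 0" using iz fing by auto
    ultimately have "card (g z) = 1" using g2[of z] by linarith
    then have "g z = {i}" using iz by (auto simp: card_1_singleton_iff)
    then show ?thesis using z by blast
  qed
  \<comment> \<open>Each vertex of \<open>i\<close> lies on at most one other edge of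
    \<open>G\<close>. Two private vertices would leave three vertices of \<open>i\<close> to meet
    the other four edges.\<close>
  have unique: "z = z'" if z: "g z = {i}" "g z' = {i}" for i z z'
  proof (rule ccontr)
    assume ne: "z \<noteq> z'"
    have i: "i \<in> G" "z \<in> i" "z' \<in> i" using z by (auto simp: g_def)
    have fi: "finite (i - {z, z'})" using c5[OF GE(1)[OF i(1)]] by simp
    have "G - {i} \<subseteq> (\<Union>x\<in>i - {z, z'}. g x - {i})"
    proof
      fix j assume j: "j \<in> G - {i}"
      then obtain x where x: "x \<in> i" "x \<in> j" using meet[of i j] GE i by blast
      then have "j \<in> g x" using j by (auto simp: g_def)
      moreover from this have "x \<noteq> z" "x \<noteq> z'" using z j by auto
      ultimately show "j \<in> (\<Union>x\<in>i - {z, z'}. g x - {i})" using x j by blast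
    qed
    then have "card (G - {i}) \<le> card (\<Union>x\<in>i - {z, z'}. g x - {i})"
      using fi fing by (intro card_mono) auto
    also have "\<dots> \<le> (\<Sum>x\<in>i - {z, z'}. card (g x - {i}))" by (rule card_UN_le[OF fi])
    also have "\<dots> \<le> (\<Sum>x\<in>i - {z, z'}. 1)"
    proof (rule sum_mono)
      fix x assume "x \<in> i - {z, z'}"
      then have "i \<in> g x" using i by (auto simp: g_def)
      then show "card (g x - {i}) \<le> 1" using g2[of x] by simp
    qed
    also have "\<dots> = 3" using c5[OF GE(1)[OF i(1)]] i ne by simp
    finally show False using cG i by simp
  qed
  show False
  proof (rule no_cross_intersecting_pair_systems[of F G X g, OF cF cG])
    fix e assume e: "e \<in> F"
    show "finite (X e)" using c5[OF FE(1)[OF e]] by (simp add: X_def)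
    \<comment> \<open>The four vertices of \<open>e\<close> other than \<open>v\<close> meet all
      five edges of \<open>G\<close>, and those outside \<open>X e\<close> lie on at most one
      each.\<close>
    show "card (X e) < card (\<Union>(g ` X e))"
    proof -
      have "G \<subseteq> \<Union>(g ` X e) \<union> (\<Union>x\<in>e - {v} - X e. g x)"
      proof
        fix i assume i: "i \<in> G"
        then obtain x where x: "x \<in> e" "x \<in> i" using meet[OF FE(1)[OF e] GE(1)[OF i]] by blast
        moreover have "x \<noteq> v" using GE[OF i] x by blast
        ultimately show "i \<in> \<Union>(g ` X e) \<union> (\<Union>x\<in>e - {v} - X e. g x)" using i by (auto simp: g_def)
      qed
      then have "card G \<le> card (\<Union>(g ` X e) \<union> (\<Union>x\<in>e - {v} - X e. g x))"
        using c5[OF FE(1)[OF e]] fing by (intro card_mono) (auto simp: X_def)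
      also have "\<dots> \<le> card (\<Union>(g ` X e)) + card (\<Union>x\<in>e - {v} - X e. g x)" by (rule card_Un_le)
      also have "card (\<Union>x\<in>e - {v} - X e. g x) \<le> (\<Sum>x\<in>e - {v} - X e. card (g x))"
        using c5[OF FE(1)[OF e]] by (intro card_UN_le) simp
      also have "\<dots> \<le> (\<Sum>x\<in>e - {v} - X e. 1)"
      proof (rule sum_mono)
        fix x assume "x \<in> e - {v} - X e"
        then have "card (g x) \<noteq> 2" by (auto simp: X_def)
        then show "card (g x) \<le> 1" using g2[of x] by simp
      qed
      also have "\<dots> = card (e - {v} - X e)" by simp
      also have "\<dots> = 4 - card (X e)"
        using c5[OF FE(1)[OF e]] FE[OF e] Xe by (subst card_Diff_subset) (auto intro: finite_subset[of _ e])
      finally have "5 \<le> card (\<Union>(g ` X e)) + (4 - card (X e))" using cG by simp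
      moreover have "card (X e) \<le> card (e - {v})"
        using c5[OF FE(1)[OF e]] Xe by (intro card_mono) auto
      then have "card (X e) \<le> 4" using c5[OF FE(1)[OF e]] FE[OF e] by simp
      ultimately show ?thesis by simp
    qed
  next
    fix e x assume "e \<in> F" "x \<in> X e"
    then show "g x \<subseteq> G \<and> card (g x) = 2" using gG Xe by blast
  next
    fix e e' x y assume e: "e \<in> F" "e' \<in> F" "e \<noteq> e'" and x: "x \<in> X e" and y: "y \<in> X e'"
    show "g x \<inter> g y \<noteq> {}"
    proof
      \<comment> \<open>Then \<open>x\<close> and \<open>y\<close> together hit \<open>e\<close>,
        \<open>e'\<close> and four edges of \<open>G\<close>.\<close>
      assume "g x \<inter> g y = {}"
      then have "card (insert e (insert e' (g x \<union> g y))) = 6"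
        using e Fg fing Xe(3)[OF x] Xe(3)[OF y] by (simp add: card_Un_disjoint)
      then show False
        using e FE gG GE Xe(1)[OF x] Xe(1)[OF y]
        by (intro six[of "insert e (insert e' (g x \<union> g y))" x y]) (auto simp: g_def)
    qed
  next
    fix e e' e'' i x
    assume e: "e \<in> F" "e' \<in> F" "e'' \<in> F" "e \<noteq> e'" "e \<noteq> e''" "e' \<noteq> e''"
      and i: "i \<in> G" "i \<notin> \<Union>(g ` X e)" "i \<notin> \<Union>(g ` X e')" and x: "x \<in> X e''"
    \<comment> \<open>Both \<open>e\<close> and \<open>e'\<close> contain a vertex private to
      \<open>i\<close>, and by \<open>unique\<close> it is the same one.\<close>
    obtain z where z: "z \<in> e" "z \<in> e'" "g z = {i}"
      using single[OF e(1) i(1,2)] single[OF e(2) i(1,3)] unique by metis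
    then have zi: "z \<in> i" by (auto simp: g_def)
    show "i \<in> g x"
    proof (rule ccontr)
      assume "i \<notin> g x"
      \<comment> \<open>Here \<open>z\<close> hits \<open>e\<close>, \<open>e'\<close> and
        \<open>i\<close>, while \<open>x\<close> hits \<open>e''\<close> and the two edges of
        \<open>g x\<close>.\<close>
      then have "card (insert e (insert e' (insert e'' (insert i (g x))))) = 6"
        using e i(1) FE(3) Fg fing Xe(3)[OF x] by (auto simp: card_insert_if)
      then show False
        using e i FE gG GE Xe(1)[OF x] z zi
        by (intro six[of "insert e (insert e' (insert e'' (insert i (g x))))" x z]) (auto simp: g_def)
    qed
  next
    fix e e' e'' c
    assume e: "e \<in> F" "e' \<in> F" "e'' \<in> F" "e \<noteq> e'" "e \<noteq> e''" "e' \<noteq> e''"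
      and c: "c \<in> G" "\<forall>x\<in>X e \<union> X e' \<union> X e''. c \<in> g x"
    \<comment> \<open>A common vertex would lie on \<open>a\<close>, \<open>b\<close> and two edges
      of \<open>G\<close>; since it misses at least five edges, there would be nine.\<close>
    have dis: "X a \<inter> X b = {}" if ab: "a \<in> F" "b \<in> F" "a \<noteq> b" for a b
    proof (rule ccontr)
      assume "X a \<inter> X b \<noteq> {}"
      then obtain x where x: "x \<in> X a" "x \<in> X b" by blast
      have "insert a (insert b (g x)) \<subseteq> {e \<in> E. x \<in> e}"
        using ab FE GE Xe(1)[OF x(1)] Xe(1)[OF x(2)] by (auto simp: g_def)
      then have "card (insert a (insert b (g x))) \<le> card {e \<in> E. x \<in> e}"
        using fin by (intro card_mono) auto
      moreover have "card (insert a (insert b (g x))) = 4"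
        using ab Fg fing Xe(3)[OF x(1)] by simp
      ultimately show False using one[of x] split[of "\<lambda>e. x \<in> e"] card by simp
    qed
    have fX: "finite (X a)" if "a \<in> F" for a using c5[OF FE(1)[OF that]] by (simp add: X_def)
    have "card (X e) + card (X e') + card (X e'') = card (X e \<union> X e' \<union> X e'')"
      using dis e fX by (simp add: card_Un_disjoint Int_Un_distrib2)
    also have "\<dots> \<le> card c" using c c5[OF GE(1)[OF c(1)]] by (intro card_mono) (auto simp: g_def)
    finally show "card (X e) + card (X e') + card (X e'') \<le> 5" using c5[OF GE(1)[OF c(1)]] by simp
  qed
qed

section \<open>Twelve edges: a cover of size 4\<close>

lemma coverable_4_if_card_le_12:
  assumes fin: "finite E" and unif: "uniform 5 E" and int: "intersecting E" and card: "card E \<le> 12"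
  shows "coverable 4 E"
proof -
  \<comment> \<open>If every vertex missed 9 edges, degrees would be at most 12 - 9 = 3, giving at
    most 5 * 2 + 1 = 11 edges; then degrees are at most 2, giving at most 6 edges.\<close>
  have "\<exists>v. card {e \<in> E. v \<notin> e} \<le> 8"
  proof (rule ccontr)
    assume "\<not> ?thesis"
    then have rest: "9 \<le> card {e \<in> E. v \<notin> e}" for v by (metis Suc_leI Suc_numeral linorder_not_le semiring_norm(5))
    have split: "card {e \<in> E. v \<in> e} + card {e \<in> E. v \<notin> e} = card E" for v
      using fin by (subst card_Un_disjoint[symmetric]) (auto intro: arg_cong[where f = card])
    have "card {e \<in> E. v \<in> e} \<le> Suc 2" for v using rest[of v] split[of v] card by simp
    then have "card E \<le> 11" using card_le_if_degrees_le[OF _ fin unif int, of 2] by simp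
    then have "card {e \<in> E. v \<in> e} \<le> Suc 1" for v using rest[of v] split[of v] by simp
    then have "card E \<le> 6" using card_le_if_degrees_le[OF _ fin unif int, of 1] by simp
    \<comment> \<open>Here \<open>undefined\<close> is just an arbitrary vertex: it cannot miss 9 of
      at most 6 edges.\<close>
    then show False using rest[of undefined] split[of undefined] by simp
  qed
  then obtain v where "card {e \<in> E. v \<notin> e} \<le> 8" by blast
  then have "coverable 3 {e \<in> E. v \<notin> e}"
    using fin unif int by (intro coverable_3_if_card_le_8) (auto intro: intersecting_subset uniform_subset)
  then show ?thesis using coverable_Suc[of 3 E v] by simp
qed

section \<open>An example with 13 edges\<close>

text \<open>Branches over the vertices of the first edge that is still uncovered.\<close>

fun branching_cover :: "nat \<Rightarrow> 'a list list \<Rightarrow> bool" where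
  "branching_cover k [] = True"
| "branching_cover 0 (e # es) = False"
| "branching_cover (Suc k) (e # es) =
    list_ex (\<lambda>v. branching_cover k (filter (\<lambda>f. \<not> List.member f v) es)) e"

text \<open>Some \<open>v\<close> in \<open>C\<close> lies on the first edge, and
  \<open>C - {v}\<close> still meets every edge avoiding \<open>v\<close>. A failed search thus
  excludes all covers of size at most \<open>k\<close>.\<close>

lemma branching_cover_if_cover:
  assumes "finite C" "card C \<le> k" "\<forall>e\<in>set es. C \<inter> set e \<noteq> {}"
  shows "branching_cover k es"
  using assms
proof (induction k es arbitrary: C rule: branching_cover.induct)
  case (3 k e es)
  then obtain v where v: "v \<in> C" "v \<in> set e" by auto
  have "branching_cover k (filter (\<lambda>f. \<not> List.member f v) es)"
    using 3 v by (intro "3.IH"[of v "C - {v}"]) auto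
  then show ?case using v by (auto simp: list_ex_iff)
qed auto

text \<open>Found by simulated annealing on the number of disjoint pairs of edges and of covers of size 4.\<close>

definition thirteen_edges :: "nat list list" where
  "thirteen_edges = [
    [0, 1, 3, 11, 16],
    [0, 2, 4, 8, 10],
    [0, 3, 5, 12, 15],
    [1, 2, 6, 7, 15],
    [1, 5, 7, 10, 13],
    [2, 3, 13, 14, 17],
    [2, 5, 9, 12, 16],
    [3, 6, 7, 8, 9],
    [4, 5, 6, 11, 17],
    [4, 8, 13, 15, 16],
    [6, 10, 12, 16, 17],
    [7, 8, 11, 12, 14],
    [9, 10, 11, 14, 15]]"

lemma thirteen_edges_uniform:
  "list_all (\<lambda>e. distinct e \<and> length e = 5 \<and> list_all (\<lambda>v. v < 18) e) thirteen_edges"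
  by code_simp

lemma thirteen_edges_intersecting:
  "list_all (\<lambda>e. list_all (\<lambda>f. list_ex (List.member f) e) thirteen_edges) thirteen_edges"
  by code_simp

lemma thirteen_edges_distinct: "distinct (map set thirteen_edges)"
  by code_simp

lemma thirteen_edges_not_covered: "\<not> branching_cover 4 thirteen_edges"
  by code_simp


section \<open>Covering numbers\<close>

lemma card_le_12_imp_covering_number_le_4:
  assumes H: "hypergraph V E" and "uniform 5 E" "intersecting E" "card E \<le> 12"
  shows "covering_number V E \<le> 4"
proof -
  have "E \<subseteq> Pow V" "finite V" using H by (auto simp: hypergraph_def)
  then have "finite E" by (meson finite_Pow_iff finite_subset)
  then obtain C where C: "finite C" "card C \<le> 4" "\<forall>e\<in>E. C \<inter> e \<noteq> {}"
    using coverable_4_if_card_le_12[of E] assms by (auto simp: coverable_def)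
  \<comment> \<open>\<open>coverable\<close> does not confine \<open>C\<close> to \<open>V\<close>,
    but edges lie in \<open>V\<close>, so \<open>C \<inter> V\<close> still meets them.\<close>
  have "cover V E (C \<inter> V)" using C(3) H by (fastforce simp: cover_def hypergraph_def)
  then have "covering_number V E \<le> card (C \<inter> V)"
    unfolding covering_number_def by (intro Least_le) blast
  also have "\<dots> \<le> card C" using C(1) by (intro card_mono) auto
  finally show ?thesis using C(2) by simp
qed

lemma ex_covering_number_5_card_13:
  "\<exists>(V :: nat set) E. hypergraph V E \<and> uniform 5 E \<and> intersecting E \<and>
     covering_number V E = 5 \<and> card E = 13"
proof (intro exI conjI)
  let ?V = "{..<18::nat}" and ?E = "set (map set thirteen_edges)"
  show hyp: "hypergraph ?V ?E"
    using thirteen_edges_uniform by (auto simp: hypergraph_def list_all_iff)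
  show unif: "uniform 5 ?E"
    using thirteen_edges_uniform by (auto simp: uniform_def list_all_iff distinct_card)
  show int: "intersecting ?E"
    using thirteen_edges_intersecting by (fastforce simp: intersecting_def list_all_iff list_ex_iff)
  show card: "card ?E = 13"
    using distinct_card[OF thirteen_edges_distinct] by (simp add: thirteen_edges_def)
  then obtain e where e: "e \<in> ?E" by (metis card.empty equals0I zero_neq_numeral)
  \<comment> \<open>In an intersecting family each edge is itself a cover, here of size 5.\<close>
  have "cover ?V ?E e" using int hyp e by (auto simp: cover_def intersecting_def hypergraph_def)
  moreover have "card e = 5" using unif e by (auto simp: uniform_def)
  moreover have "5 \<le> card C" if "cover ?V ?E C" for C
  proof (rule ccontr)
    assume "\<not> 5 \<le> card C"
    moreover have "finite C" "\<forall>e\<in>set thirteen_edges. C \<inter> set e \<noteq> {}"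
      using that by (auto simp: cover_def intro: finite_subset)
    ultimately show False
      using branching_cover_if_cover[of C 4 thirteen_edges] thirteen_edges_not_covered by simp
  qed
  ultimately show "covering_number ?V ?E = 5"
    unfolding covering_number_def by (intro Least_equality) blast+
qed

theorem mainTheorem1:
  shows "(\<exists>(V :: nat set) E. hypergraph V E \<and> uniform 5 E \<and> intersecting E \<and>
            covering_number V E = 5 \<and> card E = 13) \<and>
         (\<forall>(V :: 'a set) E. hypergraph V E \<and> uniform 5 E \<and> intersecting E \<and>
            covering_number V E = 5 \<longrightarrow> 13 \<le> card E)"
proof (intro conjI allI impI)
  show "\<exists>(V :: nat set) E. hypergraph V E \<and> uniform 5 E \<and> intersecting E \<and>
      covering_number V E = 5 \<and> card E = 13"
    by (rule ex_covering_number_5_card_13)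
next
  fix V :: "'a set" and E
  assume "hypergraph V E \<and> uniform 5 E \<and> intersecting E \<and> covering_number V E = 5"
  then show "13 \<le> card E" using card_le_12_imp_covering_number_le_4[of V E] by linarith
qed

end
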